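(* Let $L:\mathbb{A}\to\mathbb{B}$, $R:\mathbb{B}\to\mathbb{A}$ be functors and $\eta:I_{\mathbb{A}}\to RL$, $\tilde\varepsilon:RL\to I_{\mathbb{A}}$ natural transformations. Let $\mathbb{K}$ be an ideal class of $LR$-comodule morphisms and suppose that $L\tilde\varepsilon_{R(B)}:LRLR(B)\to LR(B)$ is in $\mathbb{K}$ for every $B\in\mathbb{B}$. (1) If $(B,\omega)$ is a $\mathbb{K}$-cofirm non-counital $LR$-comodule, then there is a unique $\varrho:LR(B)\to B$ in $\mathbb{K}$ making $(B,\varrho,\omega)$ a Frobenius bimodule. (2) With this module structure, $LR$-comodule morphisms between $\mathbb{K}$-cofirm $LR$-comodules $(B,\omega)$ and $(B',\omega')$ are morphisms of the Frobenius bimodules $(B,\varrho,\omega)$ and $(B',\varrho',\omega')$.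
   Context: $(LR,L\eta R)$ is a non-counital comonad and $(LR,L\tilde\varepsilon R)$ a non-unital monad on $\mathbb{B}$. $LR$-comodules are (non-counital) pairs $(B,\omega)$, $\omega:B\to LR(B)$, with $LR(\omega)\cdot\omega=L\eta_{R(B)}\cdot\omega$; $LR$-modules are (non-unital) pairs $(B,\varrho)$, $\varrho:LR(B)\to B$, with $\varrho\cdot LR(\varrho)=\varrho\cdot L\tilde\varepsilon_{R(B)}$. $LR(B)$ is regarded as a comodule via $L\eta_{R(B)}$. Morphisms commute with the structure maps. A class $\mathbb{K}$ of morphisms in a category is an ideal class if for composable $f,g$, whenever $f$ or $g$ is in $\mathbb{K}$, then $g\cdot f$ is in $\mathbb{K}$. Here $\mathbb{K}$ is an ideal class in the category of non-counital $LR$-comodules. A cofork $B\xrightarrow{k}C\rightrightarrows D$ (with $f\cdot k=g\cdot k$ for the parallel pair $f,g$) is a $\mathbb{K}$-equaliser if $k\in\mathbb{K}$ and for any $h:Q\to C$ in $\mathbb{K}$ with $f\cdot h=g\cdot h$ there is a unique $q:Q\to B$ in $\mathbb{K}$ with $h=k\cdot q$; one then has: for $s,t:X\to B$ in $\mathbb{K}$, $k\cdot s=k\cdot t$ implies $s=t$. An $LR$-comodule $(B,\omega)$ is $\mathbb{K}$-cofirm if the cofork $B\xrightarrow{\omega}LR(B)\rightrightarrows LRLR(B)$ with parallel pair $L\eta_{R(B)}$, $LR(\omega)$ is a $\mathbb{K}$-equaliser in the category of non-counital $LR$-comodules. A Frobenius bimodule is a triple $(B,\varrho,\omega)$ with $(B,\varrho)$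 an $LR$-module, $(B,\omega)$ an $LR$-comodule and $LR(\varrho)\cdot L\eta_{R(B)}=\omega\cdot\varrho=L\tilde\varepsilon_{R(B)}\cdot LR(\omega)$. Morphisms of Frobenius bimodules are morphisms in $\mathbb{B}$ that are both $LR$-module and $LR$-comodule morphisms. *)

theory Defs
  imports Main
begin

section \<open>Categories, functors, natural transformations\<close>

record ('o, 'm) category =
  Obj :: "'o set"
  Arr :: "'m set"
  Dom :: "'m \<Rightarrow> 'o"
  Cod :: "'m \<Rightarrow> 'o"
  Id :: "'o \<Rightarrow> 'm"
  Comp :: "'m \<Rightarrow> 'm \<Rightarrow> 'm"  (infixl "\<cdot>\<index>" 70)

text \<open>\<open>g \<cdot>\<^bsub>C\<^esub> f\<close> is \<open>g\<close> after \<open>f\<close>; its value is only meaningful for composable arrows.\<close>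

definition hom :: "('o, 'm) category \<Rightarrow> 'o \<Rightarrow> 'o \<Rightarrow> 'm set" where
  "hom C X Y = {f \<in> Arr C. Dom C f = X \<and> Cod C f = Y}"

definition is_category :: "('o, 'm) category \<Rightarrow> bool" where
  "is_category C \<longleftrightarrow>
     (\<forall>f \<in> Arr C. Dom C f \<in> Obj C \<and> Cod C f \<in> Obj C) \<and>
     (\<forall>X \<in> Obj C. Id C X \<in> hom C X X) \<and>
     (\<forall>X Y Z. \<forall>f \<in> hom C X Y. \<forall>g \<in> hom C Y Z. g \<cdot>\<^bsub>C\<^esub> f \<in> hom C X Z) \<and>
     (\<forall>X Y. \<forall>f \<in> hom C X Y. f \<cdot>\<^bsub>C\<^esub> Id C X = f \<and> Id C Y \<cdot>\<^bsub>C\<^esub> f = f) \<and>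
     (\<forall>W X Y Z. \<forall>f \<in> hom C W X. \<forall>g \<in> hom C X Y. \<forall>h \<in> hom C Y Z.
        h \<cdot>\<^bsub>C\<^esub> (g \<cdot>\<^bsub>C\<^esub> f) = (h \<cdot>\<^bsub>C\<^esub> g) \<cdot>\<^bsub>C\<^esub> f)"

record ('o, 'm, 'p, 'n) func =
  OMap :: "'o \<Rightarrow> 'p"
  AMap :: "'m \<Rightarrow> 'n"

definition is_functor ::
  "('o, 'm) category \<Rightarrow> ('p, 'n) category \<Rightarrow> ('o, 'm, 'p, 'n) func \<Rightarrow> bool" where
  "is_functor C D F \<longleftrightarrow>
     (\<forall>X \<in> Obj C. OMap F X \<in> Obj D) \<and>
     (\<forall>X Y. \<forall>f \<in> hom C X Y. AMap F f \<in> hom D (OMap F X) (OMap F Y)) \<and>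
     (\<forall>X \<in> Obj C. AMap F (Id C X) = Id D (OMap F X)) \<and>
     (\<forall>X Y Z. \<forall>f \<in> hom C X Y. \<forall>g \<in> hom C Y Z.
        AMap F (g \<cdot>\<^bsub>C\<^esub> f) = AMap F g \<cdot>\<^bsub>D\<^esub> AMap F f)"

definition id_func :: "('o, 'm, 'o, 'm) func" where
  "id_func = \<lparr>OMap = (\<lambda>X. X), AMap = (\<lambda>f. f)\<rparr>"

definition comp_func ::
  "('p, 'n, 'q, 'k) func \<Rightarrow> ('o, 'm, 'p, 'n) func \<Rightarrow> ('o, 'm, 'q, 'k) func"
  (infixl "\<circ>\<^sub>F" 75) where
  "G \<circ>\<^sub>F F = \<lparr>OMap = (\<lambda>X. OMap G (OMap F X)), AMap = (\<lambda>f. AMap G (AMap F f))\<rparr>"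

definition is_nat_trans ::
  "('o, 'm) category \<Rightarrow> ('p, 'n) category \<Rightarrow> ('o, 'm, 'p, 'n) func \<Rightarrow>
   ('o, 'm, 'p, 'n) func \<Rightarrow> ('o \<Rightarrow> 'n) \<Rightarrow> bool" where
  "is_nat_trans C D F G t \<longleftrightarrow>
     (\<forall>X \<in> Obj C. t X \<in> hom D (OMap F X) (OMap G X)) \<and>
     (\<forall>X Y. \<forall>f \<in> hom C X Y. AMap G f \<cdot>\<^bsub>D\<^esub> t X = t Y \<cdot>\<^bsub>D\<^esub> AMap F f)"

text \<open>The family with components \<open>L t\<^bsub>R(X)\<^esub>\<close>.\<close>

definition whisker ::
  "('p, 'n, 'q, 'k) func \<Rightarrow> ('p \<Rightarrow> 'n) \<Rightarrow> ('o, 'm, 'p, 'r) func \<Rightarrow> 'o \<Rightarrow> 'k" where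
  "whisker L t R X = AMap L (t (OMap R X))"

section \<open>Comodules, modules and Frobenius bimodules\<close>

text \<open>
  Here \<open>T\<close> is an endofunctor of \<open>C\<close> with \<open>\<delta> : T \<rightarrow> T T\<close> and \<open>\<mu> : T T \<rightarrow> T\<close>. In the
  application \<open>T = L R\<close>, \<open>\<delta> = L \<eta> R\<close> and \<open>\<mu> = L \<epsilon> R\<close>. There is no counit or unit.
\<close>

definition comodules ::
  "('o, 'm) category \<Rightarrow> ('o, 'm, 'o, 'm) func \<Rightarrow> ('o \<Rightarrow> 'm) \<Rightarrow> ('o \<times> 'm) set" where
  "comodules C T \<delta> = {(X, \<omega>). X \<in> Obj C \<and> \<omega> \<in> hom C X (OMap T X) \<and>
     AMap T \<omega> \<cdot>\<^bsub>C\<^esub> \<omega> = \<delta> X \<cdot>\<^bsub>C\<^esub> \<omega>}"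

definition modules ::
  "('o, 'm) category \<Rightarrow> ('o, 'm, 'o, 'm) func \<Rightarrow> ('o \<Rightarrow> 'm) \<Rightarrow> ('o \<times> 'm) set" where
  "modules C T \<mu> = {(X, \<rho>). X \<in> Obj C \<and> \<rho> \<in> hom C (OMap T X) X \<and>
     \<rho> \<cdot>\<^bsub>C\<^esub> AMap T \<rho> = \<rho> \<cdot>\<^bsub>C\<^esub> \<mu> X}"

definition comodule_hom ::
  "('o, 'm) category \<Rightarrow> ('o, 'm, 'o, 'm) func \<Rightarrow> 'o \<times> 'm \<Rightarrow> 'o \<times> 'm \<Rightarrow> 'm set" where
  "comodule_hom C T = (\<lambda>(X, \<omega>) (Y, \<omega>').
     {f \<in> hom C X Y. \<omega>' \<cdot>\<^bsub>C\<^esub> f = AMap T f \<cdot>\<^bsub>C\<^esub> \<omega>})"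

definition module_hom ::
  "('o, 'm) category \<Rightarrow> ('o, 'm, 'o, 'm) func \<Rightarrow> 'o \<times> 'm \<Rightarrow> 'o \<times> 'm \<Rightarrow> 'm set" where
  "module_hom C T = (\<lambda>(X, \<rho>) (Y, \<rho>').
     {f \<in> hom C X Y. f \<cdot>\<^bsub>C\<^esub> \<rho> = \<rho>' \<cdot>\<^bsub>C\<^esub> AMap T f})"

definition frobenius_bimodules ::
  "('o, 'm) category \<Rightarrow> ('o, 'm, 'o, 'm) func \<Rightarrow> ('o \<Rightarrow> 'm) \<Rightarrow> ('o \<Rightarrow> 'm) \<Rightarrow>
   ('o \<times> 'm \<times> 'm) set" where
  "frobenius_bimodules C T \<delta> \<mu> = {(X, \<rho>, \<omega>).
     (X, \<rho>) \<in> modules C T \<mu> \<and> (X, \<omega>) \<in> comodules C T \<delta> \<and>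
     AMap T \<rho> \<cdot>\<^bsub>C\<^esub> \<delta> X = \<omega> \<cdot>\<^bsub>C\<^esub> \<rho> \<and>
     \<omega> \<cdot>\<^bsub>C\<^esub> \<rho> = \<mu> X \<cdot>\<^bsub>C\<^esub> AMap T \<omega>}"

definition frobenius_hom ::
  "('o, 'm) category \<Rightarrow> ('o, 'm, 'o, 'm) func \<Rightarrow> 'o \<times> 'm \<times> 'm \<Rightarrow> 'o \<times> 'm \<times> 'm \<Rightarrow> 'm set" where
  "frobenius_hom C T = (\<lambda>(X, \<rho>, \<omega>) (Y, \<rho>', \<omega>').
     module_hom C T (X, \<rho>) (Y, \<rho>') \<inter> comodule_hom C T (X, \<omega>) (Y, \<omega>'))"

text \<open>
  Arrows of the category of comodules are triples (source, underlying arrow, target), since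
  the same arrow of \<open>C\<close> may underlie morphisms between different comodules.
\<close>

definition comodule_category ::
  "('o, 'm) category \<Rightarrow> ('o, 'm, 'o, 'm) func \<Rightarrow> ('o \<Rightarrow> 'm) \<Rightarrow>
   ('o \<times> 'm, ('o \<times> 'm) \<times> 'm \<times> ('o \<times> 'm)) category" where
  "comodule_category C T \<delta> = \<lparr>
     Obj = comodules C T \<delta>,
     Arr = {(M, f, N). M \<in> comodules C T \<delta> \<and> N \<in> comodules C T \<delta> \<and> f \<in> comodule_hom C T M N},
     Dom = (\<lambda>(M, f, N). M),
     Cod = (\<lambda>(M, f, N). N),
     Id = (\<lambda>M. (M, Id C (fst M), M)),
     Comp = (\<lambda>(M', g, N') (M, f, N). (M, g \<cdot>\<^bsub>C\<^esub> f, N'))\<rparr>"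

lemma hom_comodule_category:
  "a \<in> hom (comodule_category C T \<delta>) M N \<longleftrightarrow>
     (\<exists>f. a = (M, f, N) \<and> M \<in> comodules C T \<delta> \<and> N \<in> comodules C T \<delta> \<and> f \<in> comodule_hom C T M N)"
  by (auto simp: hom_def comodule_category_def)

lemma is_category_comodule_category:
  assumes C: "is_category C" and T: "is_functor C C T"
  shows "is_category (comodule_category C T \<delta>)"
proof -
  have closed: "g \<cdot>\<^bsub>C\<^esub> f \<in> comodule_hom C T (X, \<omega>) (Z, \<omega>'')"
    if f: "f \<in> comodule_hom C T (X, \<omega>) (Y, \<omega>')"
      and g: "g \<in> comodule_hom C T (Y, \<omega>') (Z, \<omega>'')"
      and w: "(X, \<omega>) \<in> comodules C T \<delta>" "(Y, \<omega>') \<in> comodules C T \<delta>"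
        "(Z, \<omega>'') \<in> comodules C T \<delta>"
    for f g X Y Z \<omega> \<omega>' \<omega>''
  proof -
    have h: "f \<in> hom C X Y" "g \<in> hom C Y Z" "\<omega> \<in> hom C X (OMap T X)"
      "\<omega>' \<in> hom C Y (OMap T Y)" "\<omega>'' \<in> hom C Z (OMap T Z)"
      "AMap T f \<in> hom C (OMap T X) (OMap T Y)" "AMap T g \<in> hom C (OMap T Y) (OMap T Z)"
      using f g w T by (auto simp: comodule_hom_def comodules_def is_functor_def)
    have e: "\<omega>' \<cdot>\<^bsub>C\<^esub> f = AMap T f \<cdot>\<^bsub>C\<^esub> \<omega>" "\<omega>'' \<cdot>\<^bsub>C\<^esub> g = AMap T g \<cdot>\<^bsub>C\<^esub> \<omega>'"
      using f g by (auto simp: comodule_hom_def)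
    have assoc: "k \<cdot>\<^bsub>C\<^esub> (j \<cdot>\<^bsub>C\<^esub> i) = (k \<cdot>\<^bsub>C\<^esub> j) \<cdot>\<^bsub>C\<^esub> i"
      if "i \<in> hom C U V" "j \<in> hom C V W" "k \<in> hom C W S" for i j k U V W S
      using C that unfolding is_category_def by blast
    have "\<omega>'' \<cdot>\<^bsub>C\<^esub> (g \<cdot>\<^bsub>C\<^esub> f) = (AMap T g \<cdot>\<^bsub>C\<^esub> \<omega>') \<cdot>\<^bsub>C\<^esub> f"
      using assoc[OF h(1,2,5)] e by simp
    also have "\<dots> = AMap T g \<cdot>\<^bsub>C\<^esub> (AMap T f \<cdot>\<^bsub>C\<^esub> \<omega>)"
      using assoc[OF h(1,4,7)] e by simp
    also have "\<dots> = AMap T (g \<cdot>\<^bsub>C\<^esub> f) \<cdot>\<^bsub>C\<^esub> \<omega>"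
      using assoc[OF h(3,6,7)] T h(1,2) by (auto simp: is_functor_def)
    finally show ?thesis
      using C h(1,2) unfolding comodule_hom_def is_category_def by auto
  qed
  have ident: "Id C X \<in> comodule_hom C T (X, \<omega>) (X, \<omega>)"
    if "(X, \<omega>) \<in> comodules C T \<delta>" for X \<omega>
    using that C T by (auto simp: comodule_hom_def comodules_def is_functor_def is_category_def)
  have units: "f \<cdot>\<^bsub>C\<^esub> Id C X = f \<and> Id C Y \<cdot>\<^bsub>C\<^esub> f = f"
    if "f \<in> comodule_hom C T (X, \<omega>) (Y, \<omega>')" for f X Y \<omega> \<omega>'
    using that C by (auto simp: comodule_hom_def is_category_def)
  have assoc: "h \<cdot>\<^bsub>C\<^esub> (g \<cdot>\<^bsub>C\<^esub> f) = (h \<cdot>\<^bsub>C\<^esub> g) \<cdot>\<^bsub>C\<^esub> f"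
    if "f \<in> comodule_hom C T (W, a) (X, b)" "g \<in> comodule_hom C T (X, b) (Y, c)"
      "h \<in> comodule_hom C T (Y, c) (Z, d)" for f g h W X Y Z a b c d
  proof -
    have "f \<in> hom C W X" "g \<in> hom C X Y" "h \<in> hom C Y Z"
      using that by (auto simp: comodule_hom_def)
    with C show ?thesis unfolding is_category_def by blast
  qed
  have comp: "(M', g, N') \<cdot>\<^bsub>comodule_category C T \<delta>\<^esub> (M, f, N) = (M, g \<cdot>\<^bsub>C\<^esub> f, N')"
    and id: "Id (comodule_category C T \<delta>) M = (M, Id C (fst M), M)"
    and obj: "Obj (comodule_category C T \<delta>) = comodules C T \<delta>"
    for M M' N N' f g
    by (simp_all add: comodule_category_def)
  show ?thesis
    unfolding is_category_def[of "comodule_category C T \<delta>"]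
  proof (intro conjI)
    show "\<forall>f \<in> Arr (comodule_category C T \<delta>).
        Dom (comodule_category C T \<delta>) f \<in> Obj (comodule_category C T \<delta>) \<and>
        Cod (comodule_category C T \<delta>) f \<in> Obj (comodule_category C T \<delta>)"
      by (auto simp: comodule_category_def)
  qed (auto simp: hom_comodule_category comp id obj closed ident units assoc)
qed

text \<open>The object \<open>T X\<close> regarded as a comodule.\<close>

definition cofree :: "('o, 'm, 'o, 'm) func \<Rightarrow> ('o \<Rightarrow> 'm) \<Rightarrow> 'o \<Rightarrow> 'o \<times> 'm" where
  "cofree T \<delta> X = (OMap T X, \<delta> X)"

lemma cofork_of_comodules:
  assumes C: "is_category C" and T: "is_functor C C T"
    and \<delta>: "is_nat_trans C C T (T \<circ>\<^sub>F T) \<delta>"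
    and coassoc: "\<forall>X \<in> Obj C. AMap T (\<delta> X) \<cdot>\<^bsub>C\<^esub> \<delta> X = \<delta> (OMap T X) \<cdot>\<^bsub>C\<^esub> \<delta> X"
    and X: "(X, \<omega>) \<in> comodules C T \<delta>"
  shows "((X, \<omega>), \<omega>, cofree T \<delta> X) \<in> Arr (comodule_category C T \<delta>)"
    and "(cofree T \<delta> X, \<delta> X, cofree T \<delta> (OMap T X)) \<in> Arr (comodule_category C T \<delta>)"
    and "(cofree T \<delta> X, AMap T \<omega>, cofree T \<delta> (OMap T X)) \<in> Arr (comodule_category C T \<delta>)"
  using C T \<delta> coassoc X
  by (auto simp: comodule_category_def comodules_def cofree_def comodule_hom_def
      is_functor_def is_nat_trans_def comp_func_def)

section \<open>Ideal classes and relative equalisers\<close>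

definition ideal_class :: "('o, 'm) category \<Rightarrow> 'm set \<Rightarrow> bool" where
  "ideal_class C K \<longleftrightarrow> K \<subseteq> Arr C \<and>
     (\<forall>f \<in> Arr C. \<forall>g \<in> Arr C. Cod C f = Dom C g \<longrightarrow> f \<in> K \<or> g \<in> K \<longrightarrow> g \<cdot>\<^bsub>C\<^esub> f \<in> K)"

definition K_equaliser :: "('o, 'm) category \<Rightarrow> 'm set \<Rightarrow> 'm \<Rightarrow> 'm \<Rightarrow> 'm \<Rightarrow> bool" where
  "K_equaliser C K k f g \<longleftrightarrow>
     f \<in> Arr C \<and> g \<in> Arr C \<and> Dom C f = Dom C g \<and> Cod C f = Cod C g \<and>
     k \<in> Arr C \<and> Cod C k = Dom C f \<and> f \<cdot>\<^bsub>C\<^esub> k = g \<cdot>\<^bsub>C\<^esub> k \<and>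
     k \<in> K \<and>
     (\<forall>h \<in> K. Cod C h = Dom C f \<longrightarrow> f \<cdot>\<^bsub>C\<^esub> h = g \<cdot>\<^bsub>C\<^esub> h \<longrightarrow>
        (\<exists>!q. q \<in> K \<and> q \<in> hom C (Dom C h) (Dom C k) \<and> h = k \<cdot>\<^bsub>C\<^esub> q))"

definition cofirm ::
  "('o, 'm) category \<Rightarrow> ('o, 'm, 'o, 'm) func \<Rightarrow> ('o \<Rightarrow> 'm) \<Rightarrow>
   (('o \<times> 'm) \<times> 'm \<times> ('o \<times> 'm)) set \<Rightarrow> 'o \<times> 'm \<Rightarrow> bool" where
  "cofirm C T \<delta> K = (\<lambda>(X, \<omega>).
     (X, \<omega>) \<in> comodules C T \<delta> \<and>
     K_equaliser (comodule_category C T \<delta>) K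
       ((X, \<omega>), \<omega>, cofree T \<delta> X)
       (cofree T \<delta> X, \<delta> X, cofree T \<delta> (OMap T X))
       (cofree T \<delta> X, AMap T \<omega>, cofree T \<delta> (OMap T X)))"

end

(* For an arrow a : R X -> R Y, naturality of \<eta> and \<epsilon> at a says that L a is compatible with
   \<delta> = L \<eta> R and \<mu> = L \<epsilon> R. Taking a = \<eta> and a = \<epsilon> shows that \<delta> is coassociative, \<mu> is
   associative and \<delta> \<mu> = \<mu> (T \<delta>), where T = L R. Hence \<mu> (T \<omega>) is a comodule
   endomorphism of T X in K equalising \<delta> and T \<omega>, so cofirmness gives a unique \<rho> in K with
   \<omega> \<rho> = \<mu> (T \<omega>). Every remaining identity becomes true after composition with \<omega>, and \<omega> is
   left cancellable on K. *)
theory Submission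
  imports Defs
begin

section \<open>Categories, functors and relative equalisers\<close>

lemma hom_comp:
  assumes "is_category C" "f \<in> hom C X Y" "g \<in> hom C Y Z"
  shows "g \<cdot>\<^bsub>C\<^esub> f \<in> hom C X Z"
  using assms unfolding is_category_def by blast

lemma comp_assoc:
  assumes "is_category C" "f \<in> hom C W X" "g \<in> hom C X Y" "h \<in> hom C Y Z"
  shows "(h \<cdot>\<^bsub>C\<^esub> g) \<cdot>\<^bsub>C\<^esub> f = h \<cdot>\<^bsub>C\<^esub> (g \<cdot>\<^bsub>C\<^esub> f)"
  using assms unfolding is_category_def by metis

lemma is_functor_comp:
  assumes "is_functor C D F" "is_functor D E G"
  shows "is_functor C E (G \<circ>\<^sub>F F)"
proof -
  have F: "AMap F f \<in> hom D (OMap F X) (OMap F Y)" if "f \<in> hom C X Y" for f X Y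
    using assms that unfolding is_functor_def by blast
  have G: "AMap G f \<in> hom E (OMap G X) (OMap G Y)" if "f \<in> hom D X Y" for f X Y
    using assms that unfolding is_functor_def by blast
  have "AMap F (g \<cdot>\<^bsub>C\<^esub> f) = AMap F g \<cdot>\<^bsub>D\<^esub> AMap F f"
    if "f \<in> hom C X Y" "g \<in> hom C Y Z" for f g X Y Z
    using assms(1) that unfolding is_functor_def by metis
  moreover have "AMap G (g \<cdot>\<^bsub>D\<^esub> f) = AMap G g \<cdot>\<^bsub>E\<^esub> AMap G f"
    if "f \<in> hom D X Y" "g \<in> hom D Y Z" for f g X Y Z
    using assms(2) that unfolding is_functor_def by metis
  ultimately have comp: "AMap G (AMap F (g \<cdot>\<^bsub>C\<^esub> f)) = AMap G (AMap F g) \<cdot>\<^bsub>E\<^esub> AMap G (AMap F f)"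
    if "f \<in> hom C X Y" "g \<in> hom C Y Z" for f g X Y Z
    using F that by metis
  have "OMap F X \<in> Obj D" "AMap F (Id C X) = Id D (OMap F X)" if "X \<in> Obj C" for X
    using assms(1) that unfolding is_functor_def by blast+
  moreover have "OMap G X \<in> Obj E" "AMap G (Id D X) = Id E (OMap G X)" if "X \<in> Obj D" for X
    using assms(2) that unfolding is_functor_def by blast+
  ultimately show ?thesis
    using F G comp unfolding is_functor_def comp_func_def func.simps by metis
qed

lemma K_equaliser_factor:
  assumes "K_equaliser C K k f g" and "h \<in> K"
    and "Cod C h = Dom C f" and "f \<cdot>\<^bsub>C\<^esub> h = g \<cdot>\<^bsub>C\<^esub> h"
  obtains q where "q \<in> K" "q \<in> hom C (Dom C h) (Dom C k)" "h = k \<cdot>\<^bsub>C\<^esub> q"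
  using assms unfolding K_equaliser_def by blast

text \<open>The ideal property puts \<open>k \<cdot> s\<close> into \<open>K\<close>, and it
  equalises \<open>f\<close> and \<open>g\<close> because \<open>k\<close> does. Both
  \<open>s\<close> and \<open>t\<close> are then factorisations of this one morphism through
  \<open>k\<close>, so the uniqueness clause identifies them.\<close>

lemma K_equaliser_cancel:
  assumes C: "is_category C" and K: "ideal_class C K" and eq: "K_equaliser C K k f g"
    and st: "s \<in> K" "t \<in> K" "s \<in> hom C Q (Dom C k)" "t \<in> hom C Q (Dom C k)"
    and kst: "k \<cdot>\<^bsub>C\<^esub> s = k \<cdot>\<^bsub>C\<^esub> t"
  shows "s = t"
proof -
  have k: "k \<in> hom C (Dom C k) (Dom C f)" "f \<in> hom C (Dom C f) (Cod C f)"
      "g \<in> hom C (Dom C f) (Cod C f)" "f \<cdot>\<^bsub>C\<^esub> k = g \<cdot>\<^bsub>C\<^esub> k" "k \<in> K"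
    using eq unfolding K_equaliser_def hom_def by auto
  have ks: "k \<cdot>\<^bsub>C\<^esub> s \<in> hom C Q (Dom C f)"
    using hom_comp[OF C st(3) k(1)] .
  have "k \<cdot>\<^bsub>C\<^esub> s \<in> K"
    using K k(1) st(1,3) unfolding ideal_class_def hom_def by auto
  moreover have "f \<cdot>\<^bsub>C\<^esub> (k \<cdot>\<^bsub>C\<^esub> s) = g \<cdot>\<^bsub>C\<^esub> (k \<cdot>\<^bsub>C\<^esub> s)"
    using comp_assoc[OF C st(3) k(1) k(2)] comp_assoc[OF C st(3) k(1) k(3)] k(4) by simp
  moreover have "Dom C (k \<cdot>\<^bsub>C\<^esub> s) = Q" "Cod C (k \<cdot>\<^bsub>C\<^esub> s) = Dom C f"
    using ks unfolding hom_def by simp_all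
  ultimately have "\<exists>!q. q \<in> K \<and> q \<in> hom C Q (Dom C k) \<and> k \<cdot>\<^bsub>C\<^esub> s = k \<cdot>\<^bsub>C\<^esub> q"
    using eq unfolding K_equaliser_def by metis
  then show ?thesis using st kst by blast
qed

section \<open>Comodule morphisms as triples\<close>

lemma comp_comodule_category:
  "(M', g, N') \<cdot>\<^bsub>comodule_category C T \<delta>\<^esub> (M, f, N) = (M, g \<cdot>\<^bsub>C\<^esub> f, N')"
  by (simp add: comodule_category_def)

lemma Arr_comodule_category:
  "(M, f, N) \<in> Arr (comodule_category C T \<delta>) \<longleftrightarrow>
     M \<in> comodules C T \<delta> \<and> N \<in> comodules C T \<delta> \<and> f \<in> comodule_hom C T M N"
  by (simp add: comodule_category_def)

text \<open>Lets membership in \<open>K\<close> be read off from underlying arrows: the shared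
  comodule \<open>N\<close> is what makes the two triples composable.\<close>

lemma ideal_class_comodule_comp:
  assumes "ideal_class (comodule_category C T \<delta>) K"
    and "(M, f, N) \<in> Arr (comodule_category C T \<delta>)"
    and "(N, g, P) \<in> Arr (comodule_category C T \<delta>)"
    and "(M, f, N) \<in> K \<or> (N, g, P) \<in> K"
  shows "(M, g \<cdot>\<^bsub>C\<^esub> f, P) \<in> K"
proof -
  have "Cod (comodule_category C T \<delta>) (M, f, N) = Dom (comodule_category C T \<delta>) (N, g, P)"
    by (simp add: comodule_category_def)
  then have "(N, g, P) \<cdot>\<^bsub>comodule_category C T \<delta>\<^esub> (M, f, N) \<in> K"
    using assms unfolding ideal_class_def by blast
  then show ?thesis by (simp add: comp_comodule_category)
qed

section \<open>Comodules over an endofunctor with compatible \<open>\<delta>\<close> and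
  \<open>\<mu>\<close>\<close>

text \<open>Abstracts from \<open>L\<close> and \<open>R\<close> to the structure on
  \<open>T\<close> with which cofirm comodules are studied. \<open>\<delta>_coassoc\<close> makes
  each \<open>T X\<close> a comodule. \<open>\<delta>_\<mu>\<close> is the Frobenius law that turns
  \<open>\<mu> X \<odot> TA \<omega>\<close> into a morphism equalising the parallel pair of a
  comodule.\<close>

locale frobenius_endofunctor =
  fixes C :: "('o, 'm) category" and T :: "('o, 'm, 'o, 'm) func" and \<delta> \<mu> :: "'o \<Rightarrow> 'm"
  assumes category: "is_category C" and endofunctor: "is_functor C C T"
    and nat_\<delta>: "is_nat_trans C C T (T \<circ>\<^sub>F T) \<delta>"
    and nat_\<mu>: "is_nat_trans C C (T \<circ>\<^sub>F T) T \<mu>"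
    and \<delta>_coassoc: "X \<in> Obj C \<Longrightarrow> AMap T (\<delta> X) \<cdot>\<^bsub>C\<^esub> \<delta> X = \<delta> (OMap T X) \<cdot>\<^bsub>C\<^esub> \<delta> X"
    and \<mu>_assoc: "X \<in> Obj C \<Longrightarrow> \<mu> X \<cdot>\<^bsub>C\<^esub> AMap T (\<mu> X) = \<mu> X \<cdot>\<^bsub>C\<^esub> \<mu> (OMap T X)"
    and \<delta>_\<mu>: "X \<in> Obj C \<Longrightarrow> \<delta> X \<cdot>\<^bsub>C\<^esub> \<mu> X = \<mu> (OMap T X) \<cdot>\<^bsub>C\<^esub> AMap T (\<delta> X)"
begin

abbreviation cmp (infixl "\<odot>" 70) where "g \<odot> f \<equiv> g \<cdot>\<^bsub>C\<^esub> f"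
abbreviation "TO \<equiv> OMap T"
abbreviation "TA \<equiv> AMap T"
abbreviation "CoMod \<equiv> comodule_category C T \<delta>"

lemmas assoc = comp_assoc[OF category]
lemmas category_CoMod = is_category_comodule_category[OF category endofunctor]

lemma TO_obj: "X \<in> Obj C \<Longrightarrow> TO X \<in> Obj C"
  and TA_hom: "f \<in> hom C X Y \<Longrightarrow> TA f \<in> hom C (TO X) (TO Y)"
  and TA_comp: "f \<in> hom C X Y \<Longrightarrow> g \<in> hom C Y Z \<Longrightarrow> TA (g \<odot> f) = TA g \<odot> TA f"
  using endofunctor unfolding is_functor_def by auto

lemma \<delta>_hom: "X \<in> Obj C \<Longrightarrow> \<delta> X \<in> hom C (TO X) (TO (TO X))"
  and \<mu>_hom: "X \<in> Obj C \<Longrightarrow> \<mu> X \<in> hom C (TO (TO X)) (TO X)"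
  and \<delta>_nat: "f \<in> hom C X Y \<Longrightarrow> TA (TA f) \<odot> \<delta> X = \<delta> Y \<odot> TA f"
  and \<mu>_nat: "f \<in> hom C X Y \<Longrightarrow> TA f \<odot> \<mu> X = \<mu> Y \<odot> TA (TA f)"
  using nat_\<delta> nat_\<mu> unfolding is_nat_trans_def comp_func_def by auto

lemma homD: "f \<in> hom C X Y \<Longrightarrow> X \<in> Obj C" "f \<in> hom C X Y \<Longrightarrow> Y \<in> Obj C"
  using category unfolding is_category_def hom_def by auto

lemma cofree_comodule: "X \<in> Obj C \<Longrightarrow> cofree T \<delta> X \<in> comodules C T \<delta>"
  unfolding cofree_def comodules_def using TO_obj \<delta>_hom \<delta>_coassoc by auto

text \<open>This is naturality of \<open>\<delta>\<close> at \<open>f\<close>. It supplies the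
  factors \<open>TA \<omega>\<close>, \<open>TA \<rho>\<close> and \<open>TA f\<close> that the
  ideal property later absorbs into \<open>K\<close>.\<close>

lemma cofree_map:
  assumes "f \<in> hom C X Y"
  shows "(cofree T \<delta> X, TA f, cofree T \<delta> Y) \<in> Arr CoMod"
  using assms cofree_comodule homD TA_hom \<delta>_nat
  by (auto simp: Arr_comodule_category comodule_hom_def cofree_def)

lemma cofirm_comodule:
  assumes "cofirm C T \<delta> K (X, \<omega>)"
  shows "(X, \<omega>) \<in> comodules C T \<delta>" "X \<in> Obj C" "\<omega> \<in> hom C X (TO X)"
    "TA \<omega> \<odot> \<omega> = \<delta> X \<odot> \<omega>"
  using assms unfolding cofirm_def comodules_def by auto

text \<open>Carries cancellation over from triples to arrows of \<open>C\<close>. Both arrows must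
  lie in \<open>K\<close> with the same source comodule \<open>M\<close>, so each use first
  establishes these two memberships.\<close>

lemma cofirm_cancel:
  assumes K: "ideal_class CoMod K" and X: "cofirm C T \<delta> K (X, \<omega>)"
    and s: "(M, s, (X, \<omega>)) \<in> K" and t: "(M, t, (X, \<omega>)) \<in> K"
    and eq: "\<omega> \<odot> s = \<omega> \<odot> t"
  shows "s = t"
proof -
  \<comment> \<open>An ideal class consists of arrows of \<open>CoMod\<close>, so membership in
    \<open>K\<close> already contains the comodule morphism property.\<close>
  have hom: "(M, u, (X, \<omega>)) \<in> hom CoMod M (X, \<omega>)" if "(M, u, (X, \<omega>)) \<in> K" for u
    using that K unfolding ideal_class_def hom_def by (auto simp: comodule_category_def)
  have dom: "Dom CoMod ((X, \<omega>), \<omega>, cofree T \<delta> X) = (X, \<omega>)"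
    by (simp add: comodule_category_def)
  have "K_equaliser CoMod K ((X, \<omega>), \<omega>, cofree T \<delta> X)
       (cofree T \<delta> X, \<delta> X, cofree T \<delta> (TO X)) (cofree T \<delta> X, TA \<omega>, cofree T \<delta> (TO X))"
    using X unfolding cofirm_def by simp
  from K_equaliser_cancel[OF category_CoMod K this s t, of M]
  have "(M, s, (X, \<omega>)) = (M, t, (X, \<omega>))"
    using hom[OF s] hom[OF t] eq by (simp add: dom comp_comodule_category)
  then show ?thesis by simp
qed

text \<open>The factor \<open>q\<close> is obtained as a comodule morphism, not merely as an arrow
  of \<open>C\<close>; for a cofree source this yields one of the two Frobenius laws.\<close>

lemma cofirm_factor:
  assumes X: "cofirm C T \<delta> K (X, \<omega>)"
    and h: "(M, h, cofree T \<delta> X) \<in> K" "\<delta> X \<odot> h = TA \<omega> \<odot> h"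
  obtains q where "(M, q, (X, \<omega>)) \<in> K" "q \<in> comodule_hom C T M (X, \<omega>)" "\<omega> \<odot> q = h"
proof -
  have eq: "K_equaliser CoMod K ((X, \<omega>), \<omega>, cofree T \<delta> X)
       (cofree T \<delta> X, \<delta> X, cofree T \<delta> (TO X)) (cofree T \<delta> X, TA \<omega>, cofree T \<delta> (TO X))"
    using X unfolding cofirm_def by simp
  have d: "Dom CoMod (P, u, Q) = P" "Cod CoMod (P, u, Q) = Q" for P u Q
    by (simp_all add: comodule_category_def)
  have "(cofree T \<delta> X, \<delta> X, cofree T \<delta> (TO X)) \<cdot>\<^bsub>CoMod\<^esub> (M, h, cofree T \<delta> X) =
      (cofree T \<delta> X, TA \<omega>, cofree T \<delta> (TO X)) \<cdot>\<^bsub>CoMod\<^esub> (M, h, cofree T \<delta> X)"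
    using h(2) by (simp add: comp_comodule_category)
  \<comment> \<open>Unfolding \<open>d\<close> makes the open premise, matching the codomain of
    \<open>h\<close> with the source of the pair, reflexive.\<close>
  from K_equaliser_factor[OF eq h(1) _ this, unfolded d, OF refl]
  obtain q where "q \<in> hom CoMod M (X, \<omega>)" "q \<in> K"
      "(M, h, cofree T \<delta> X) = ((X, \<omega>), \<omega>, cofree T \<delta> X) \<cdot>\<^bsub>CoMod\<^esub> q"
    by blast
  then show thesis
    using that by (auto simp: hom_comodule_category comp_comodule_category)
qed

section \<open>Frobenius structures on cofirm comodules\<close>

context
  fixes K :: "(('o \<times> 'm) \<times> 'm \<times> ('o \<times> 'm)) set"
  assumes ideal: "ideal_class CoMod K"
    and \<mu>_in_K: "\<forall>X \<in> Obj C. (cofree T \<delta> (TO X), \<mu> X, cofree T \<delta> X) \<in> K"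
begin

lemma K_Arr: "a \<in> K \<Longrightarrow> a \<in> Arr CoMod"
  using ideal unfolding ideal_class_def by auto

lemma K_hom: "(cofree T \<delta> X, \<rho>, (Y, \<omega>)) \<in> K \<Longrightarrow> \<rho> \<in> hom C (TO X) Y"
  using K_Arr by (fastforce simp: Arr_comodule_category comodule_hom_def cofree_def)

text \<open>Factoring \<open>\<mu> X \<odot> TA \<omega>\<close> through \<open>\<omega>\<close>
  yields \<open>\<rho>\<close> and one Frobenius law; the other says that \<open>\<rho>\<close> is a
  comodule morphism out of the cofree comodule. The module law remains and is proved by cancelling
  \<open>\<omega>\<close>.\<close>

lemma cofirm_frobenius_exists:
  assumes X: "cofirm C T \<delta> K (X, \<omega>)"
  obtains \<rho> where "(cofree T \<delta> X, \<rho>, (X, \<omega>)) \<in> K"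
    "(X, \<rho>, \<omega>) \<in> frobenius_bimodules C T \<delta> \<mu>"
proof -
  note [simp] = cofirm_comodule(1,2)[OF X]
  note \<omega> = cofirm_comodule(3)[OF X] and coact = cofirm_comodule(4)[OF X]
  have TX: "TO X \<in> Obj C" by (simp add: TO_obj)
  note T\<omega> = TA_hom[OF \<omega>]
  note \<mu>X = \<mu>_hom[of X, simplified] and \<delta>X = \<delta>_hom[of X, simplified]
  \<comment> \<open>\<open>\<mu> X\<close> lies in \<open>K\<close> by assumption and
    \<open>TA \<omega>\<close> is a comodule morphism, so the composite lies in the ideal.\<close>
  have "(cofree T \<delta> X, \<mu> X \<odot> TA \<omega>, cofree T \<delta> X) \<in> K"
    using ideal_class_comodule_comp[OF ideal cofree_map[OF \<omega>] K_Arr] \<mu>_in_K by auto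
  moreover have "\<delta> X \<odot> (\<mu> X \<odot> TA \<omega>) = TA \<omega> \<odot> (\<mu> X \<odot> TA \<omega>)"
  proof -
    have "\<delta> X \<odot> (\<mu> X \<odot> TA \<omega>) = \<mu> (TO X) \<odot> (TA (\<delta> X) \<odot> TA \<omega>)"
      using assoc[OF T\<omega> \<mu>X \<delta>X] assoc[OF T\<omega> TA_hom[OF \<delta>X] \<mu>_hom[OF TX]]
      by (simp add: \<delta>_\<mu>)
    \<comment> \<open>The coaction identity
      \<open>TA \<omega> \<odot> \<omega> = \<delta> X \<odot> \<omega>\<close>, under
      \<open>T\<close>, replaces \<open>TA (\<delta> X)\<close>; naturality of \<open>\<mu>\<close>
      at \<open>\<omega>\<close> then moves \<open>TA \<omega>\<close> to the left.\<close>
    also have "\<dots> = \<mu> (TO X) \<odot> (TA (TA \<omega>) \<odot> TA \<omega>)"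
      using TA_comp[OF \<omega> \<delta>X] TA_comp[OF \<omega> T\<omega>] coact by simp
    also have "\<dots> = TA \<omega> \<odot> (\<mu> X \<odot> TA \<omega>)"
      using assoc[OF T\<omega> TA_hom[OF T\<omega>] \<mu>_hom[OF TX]] assoc[OF T\<omega> \<mu>X T\<omega>] \<mu>_nat[OF \<omega>] by simp
    finally show ?thesis .
  qed
  ultimately obtain \<rho> where \<rho>K: "(cofree T \<delta> X, \<rho>, (X, \<omega>)) \<in> K"
    and \<rho>: "\<rho> \<in> comodule_hom C T (cofree T \<delta> X) (X, \<omega>)"
    and \<omega>\<rho>: "\<omega> \<odot> \<rho> = \<mu> X \<odot> TA \<omega>"
    using cofirm_factor[OF X] by metis
  have \<rho>h: "\<rho> \<in> hom C (TO X) X" and \<rho>\<delta>: "\<omega> \<odot> \<rho> = TA \<rho> \<odot> \<delta> X"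
    using \<rho> by (auto simp: comodule_hom_def cofree_def)
  note T\<rho> = TA_hom[OF \<rho>h]
  \<comment> \<open>Both sides of the module law factor through \<open>\<rho>\<close> from the
    cofree comodule on \<open>T X\<close>, so both lie in \<open>K\<close> and can be compared after
    \<open>\<omega>\<close>.\<close>
  have "(cofree T \<delta> (TO X), \<rho> \<odot> TA \<rho>, (X, \<omega>)) \<in> K"
    using ideal_class_comodule_comp[OF ideal cofree_map[OF \<rho>h] K_Arr[OF \<rho>K]] \<rho>K by auto
  moreover have "(cofree T \<delta> (TO X), \<rho> \<odot> \<mu> X, (X, \<omega>)) \<in> K"
    using ideal_class_comodule_comp[OF ideal K_Arr K_Arr[OF \<rho>K]] \<mu>_in_K \<rho>K by auto
  moreover have "\<omega> \<odot> (\<rho> \<odot> TA \<rho>) = \<omega> \<odot> (\<rho> \<odot> \<mu> X)"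
  proof -
    have "\<omega> \<odot> (\<rho> \<odot> TA \<rho>) = \<mu> X \<odot> TA (\<omega> \<odot> \<rho>)"
      using assoc[OF T\<rho> \<rho>h \<omega>] assoc[OF T\<rho> T\<omega> \<mu>X] TA_comp[OF \<rho>h \<omega>] \<omega>\<rho> by simp
    \<comment> \<open>\<open>\<omega>\<rho>\<close> is applied a second time, now under
      \<open>T\<close>, and associativity of \<open>\<mu>\<close> replaces
      \<open>TA (\<mu> X)\<close> by \<open>\<mu> (TO X)\<close>.\<close>
    also have "\<dots> = \<mu> X \<odot> (\<mu> (TO X) \<odot> TA (TA \<omega>))"
      using assoc[OF TA_hom[OF T\<omega>] TA_hom[OF \<mu>X] \<mu>X]
        assoc[OF TA_hom[OF T\<omega>] \<mu>_hom[OF TX] \<mu>X] TA_comp[OF T\<omega> \<mu>X] \<omega>\<rho>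
      by (simp add: \<mu>_assoc)
    also have "\<dots> = (\<mu> X \<odot> TA \<omega>) \<odot> \<mu> X"
      using \<mu>_nat[OF \<omega>] assoc[OF \<mu>X T\<omega> \<mu>X] by simp
    also have "\<dots> = \<omega> \<odot> (\<rho> \<odot> \<mu> X)"
      using \<omega>\<rho> assoc[OF \<mu>X \<rho>h \<omega>] by simp
    finally show ?thesis .
  qed
  ultimately have "\<rho> \<odot> TA \<rho> = \<rho> \<odot> \<mu> X"
    by (rule cofirm_cancel[OF ideal X])
  then have "(X, \<rho>, \<omega>) \<in> frobenius_bimodules C T \<delta> \<mu>"
    using \<rho>h \<rho>\<delta> \<omega>\<rho> by (auto simp: frobenius_bimodules_def modules_def)
  then show thesis using that \<rho>K by blast
qed

text \<open>Uniqueness holds because a Frobenius law prescribes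
  \<open>\<omega> \<odot> \<rho>\<close> as \<open>\<mu> X \<odot> TA \<omega>\<close>, an
  expression free of \<open>\<rho>\<close>, and \<open>\<omega>\<close> is cancellable on
  \<open>K\<close>.\<close>

theorem cofirm_frobenius_unique_exists:
  assumes X: "cofirm C T \<delta> K (X, \<omega>)"
  shows "\<exists>!\<rho>. (cofree T \<delta> X, \<rho>, (X, \<omega>)) \<in> K \<and> (X, \<rho>, \<omega>) \<in> frobenius_bimodules C T \<delta> \<mu>"
proof -
  have e: "\<omega> \<odot> \<rho> = \<mu> X \<odot> TA \<omega>" if "(X, \<rho>, \<omega>) \<in> frobenius_bimodules C T \<delta> \<mu>" for \<rho>
    using that unfolding frobenius_bimodules_def by blast
  have "\<rho> = \<rho>'"
    if "(cofree T \<delta> X, \<rho>, (X, \<omega>)) \<in> K \<and> (X, \<rho>, \<omega>) \<in> frobenius_bimodules C T \<delta> \<mu>"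
      "(cofree T \<delta> X, \<rho>', (X, \<omega>)) \<in> K \<and> (X, \<rho>', \<omega>) \<in> frobenius_bimodules C T \<delta> \<mu>" for \<rho> \<rho>'
    by (rule cofirm_cancel[OF ideal X, of "cofree T \<delta> X"]) (use that e in simp_all)
  moreover obtain \<rho> where "(cofree T \<delta> X, \<rho>, (X, \<omega>)) \<in> K \<and>
      (X, \<rho>, \<omega>) \<in> frobenius_bimodules C T \<delta> \<mu>"
    using cofirm_frobenius_exists[OF X] by blast
  ultimately show ?thesis by blast
qed

text \<open>The two sides of the module condition for \<open>f\<close> are compared after
  \<open>\<omega>'\<close>, which cofirmness of the target makes cancellable. They lie in
  \<open>K\<close> because \<open>\<rho>\<close> and \<open>\<rho>'\<close> do.\<close>

theorem comodule_hom_is_frobenius_hom: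
  assumes X: "(X, \<omega>) \<in> comodules C T \<delta>"
    and \<rho>K: "(cofree T \<delta> X, \<rho>, (X, \<omega>)) \<in> K"
    and F: "(X, \<rho>, \<omega>) \<in> frobenius_bimodules C T \<delta> \<mu>"
    and X': "cofirm C T \<delta> K (X', \<omega>')"
    and \<rho>K': "(cofree T \<delta> X', \<rho>', (X', \<omega>')) \<in> K"
    and F': "(X', \<rho>', \<omega>') \<in> frobenius_bimodules C T \<delta> \<mu>"
    and f: "f \<in> comodule_hom C T (X, \<omega>) (X', \<omega>')"
  shows "f \<in> frobenius_hom C T (X, \<rho>, \<omega>) (X', \<rho>', \<omega>')"
proof -
  have [simp]: "X \<in> Obj C" and \<omega>: "\<omega> \<in> hom C X (TO X)"
    using X by (auto simp: comodules_def)
  note [simp] = cofirm_comodule(1,2)[OF X']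
  note \<omega>' = cofirm_comodule(3)[OF X']
  note \<rho> = K_hom[OF \<rho>K] and \<rho>' = K_hom[OF \<rho>K']
  note \<mu>X = \<mu>_hom[of X, simplified] and \<mu>X' = \<mu>_hom[of X', simplified]
  have e: "\<omega> \<odot> \<rho> = \<mu> X \<odot> TA \<omega>" "\<omega>' \<odot> \<rho>' = \<mu> X' \<odot> TA \<omega>'"
    using F F' by (auto simp: frobenius_bimodules_def)
  have fh: "f \<in> hom C X X'" and fe: "\<omega>' \<odot> f = TA f \<odot> \<omega>"
    using f by (auto simp: comodule_hom_def)
  note Tf = TA_hom[OF fh]
  have "(cofree T \<delta> X, f \<odot> \<rho>, (X', \<omega>')) \<in> K"
    using ideal_class_comodule_comp[OF ideal K_Arr[OF \<rho>K]] X \<rho>K f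
    by (simp add: Arr_comodule_category)
  moreover have "(cofree T \<delta> X, \<rho>' \<odot> TA f, (X', \<omega>')) \<in> K"
    using ideal_class_comodule_comp[OF ideal cofree_map[OF fh] K_Arr[OF \<rho>K']] \<rho>K' by simp
  moreover have "\<omega>' \<odot> (f \<odot> \<rho>) = \<omega>' \<odot> (\<rho>' \<odot> TA f)"
  proof -
    have "\<omega>' \<odot> (f \<odot> \<rho>) = TA f \<odot> (\<mu> X \<odot> TA \<omega>)"
      using assoc[OF \<rho> fh \<omega>'] assoc[OF \<rho> \<omega> Tf] fe e by simp
    \<comment> \<open>Naturality of \<open>\<mu>\<close> at \<open>f\<close> collects everything
      under a single \<open>T\<close>, where the comodule condition on \<open>f\<close> can be
      applied once more.\<close>
    also have "\<dots> = \<mu> X' \<odot> TA (TA f \<odot> \<omega>)"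
      using assoc[OF TA_hom[OF \<omega>] \<mu>X Tf] assoc[OF TA_hom[OF \<omega>] TA_hom[OF Tf] \<mu>X']
        \<mu>_nat[OF fh] TA_comp[OF \<omega> Tf] by simp
    also have "\<dots> = (\<mu> X' \<odot> TA \<omega>') \<odot> TA f"
      using fe TA_comp[OF fh \<omega>'] assoc[OF Tf TA_hom[OF \<omega>'] \<mu>X'] by simp
    also have "\<dots> = \<omega>' \<odot> (\<rho>' \<odot> TA f)"
      using e assoc[OF Tf \<rho>' \<omega>'] by simp
    finally show ?thesis .
  qed
  ultimately have "f \<odot> \<rho> = \<rho>' \<odot> TA f"
    by (rule cofirm_cancel[OF ideal X'])
  then show ?thesis using f fh by (auto simp: frobenius_hom_def module_hom_def)
qed

end

end

section \<open>The endofunctor \<open>LR\<close> and the proposition\<close>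

lemma frobenius_endofunctor_of_pair:
  assumes A: "is_category A" and B: "is_category B"
    and L: "is_functor A B L" and R: "is_functor B A R"
    and \<eta>: "is_nat_trans A A id_func (R \<circ>\<^sub>F L) \<eta>"
    and \<epsilon>: "is_nat_trans A A (R \<circ>\<^sub>F L) id_func \<epsilon>"
  shows "frobenius_endofunctor B (L \<circ>\<^sub>F R) (whisker L \<eta> R) (whisker L \<epsilon> R)"
proof -
  note defs = comp_func_def whisker_def
  have Lh: "AMap L f \<in> hom B (OMap L X) (OMap L Y)" if "f \<in> hom A X Y" for f X Y
    using L that unfolding is_functor_def by blast
  have Lc: "AMap L g \<cdot>\<^bsub>B\<^esub> AMap L f = AMap L (g \<cdot>\<^bsub>A\<^esub> f)"
    if "f \<in> hom A X Y" "g \<in> hom A Y Z" for f g X Y Z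
    using L that unfolding is_functor_def by metis
  have Rh: "AMap R f \<in> hom A (OMap R X) (OMap R Y)" if "f \<in> hom B X Y" for f X Y
    using R that unfolding is_functor_def by blast
  have Ro: "OMap R X \<in> Obj A" if "X \<in> Obj B" for X
    using R that unfolding is_functor_def by blast
  have Ah: "X \<in> Obj A" "Y \<in> Obj A" if "f \<in> hom A X Y" for f X Y
    using A that unfolding is_category_def hom_def by auto
  have \<eta>h: "\<eta> X \<in> hom A X (OMap R (OMap L X))"
    and \<epsilon>h: "\<epsilon> X \<in> hom A (OMap R (OMap L X)) X" if "X \<in> Obj A" for X
    using \<eta> \<epsilon> that unfolding is_nat_trans_def by (auto simp: comp_func_def id_func_def)
  \<comment> \<open>Stated for every arrow \<open>f\<close> of \<open>A\<close>, not only those of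
    the form \<open>AMap R g\<close>, so that \<open>f\<close> can also be a component of
    \<open>\<eta>\<close> or \<open>\<epsilon>\<close>.\<close>
  have \<eta>n: "AMap L (AMap R (AMap L f)) \<cdot>\<^bsub>B\<^esub> AMap L (\<eta> X) = AMap L (\<eta> Y) \<cdot>\<^bsub>B\<^esub> AMap L f"
    if f: "f \<in> hom A X Y" for f X Y
  proof -
    have "AMap R (AMap L f) \<cdot>\<^bsub>A\<^esub> \<eta> X = \<eta> Y \<cdot>\<^bsub>A\<^esub> f"
      using \<eta> f unfolding is_nat_trans_def by (auto simp: comp_func_def id_func_def)
    then show ?thesis
      using Lc[OF \<eta>h[OF Ah(1)[OF f]] Rh[OF Lh[OF f]]] Lc[OF f \<eta>h[OF Ah(2)[OF f]]] by simp
  qed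
  have \<epsilon>n: "AMap L f \<cdot>\<^bsub>B\<^esub> AMap L (\<epsilon> X) = AMap L (\<epsilon> Y) \<cdot>\<^bsub>B\<^esub> AMap L (AMap R (AMap L f))"
    if f: "f \<in> hom A X Y" for f X Y
  proof -
    have "f \<cdot>\<^bsub>A\<^esub> \<epsilon> X = \<epsilon> Y \<cdot>\<^bsub>A\<^esub> AMap R (AMap L f)"
      using \<epsilon> f unfolding is_nat_trans_def by (auto simp: comp_func_def id_func_def)
    then show ?thesis
      using Lc[OF \<epsilon>h[OF Ah(1)[OF f]] f] Lc[OF Rh[OF Lh[OF f]] \<epsilon>h[OF Ah(2)[OF f]]] by simp
  qed
  show ?thesis
  proof
    \<comment> \<open>Naturality over \<open>B\<close> is the square \<open>\<eta>n\<close> at the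
      image under \<open>R\<close> of an arrow of \<open>B\<close>; the same holds for
      \<open>\<epsilon>n\<close> below.\<close>
    show "is_nat_trans B B (L \<circ>\<^sub>F R) ((L \<circ>\<^sub>F R) \<circ>\<^sub>F (L \<circ>\<^sub>F R)) (whisker L \<eta> R)"
      unfolding is_nat_trans_def defs func.simps by (intro conjI ballI allI Lh \<eta>h Ro \<eta>n Rh)
    show "is_nat_trans B B ((L \<circ>\<^sub>F R) \<circ>\<^sub>F (L \<circ>\<^sub>F R)) (L \<circ>\<^sub>F R) (whisker L \<epsilon> R)"
      unfolding is_nat_trans_def defs func.simps by (intro conjI ballI allI Lh \<epsilon>h Ro \<epsilon>n Rh)
  next
    fix X assume "X \<in> Obj B"
    note \<eta>X = \<eta>h[OF Ro[OF this]] and \<epsilon>X = \<epsilon>h[OF Ro[OF this]]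
    show "AMap (L \<circ>\<^sub>F R) (whisker L \<eta> R X) \<cdot>\<^bsub>B\<^esub> whisker L \<eta> R X =
        whisker L \<eta> R (OMap (L \<circ>\<^sub>F R) X) \<cdot>\<^bsub>B\<^esub> whisker L \<eta> R X"
      unfolding defs func.simps by (rule \<eta>n[OF \<eta>X])
    show "whisker L \<epsilon> R X \<cdot>\<^bsub>B\<^esub> AMap (L \<circ>\<^sub>F R) (whisker L \<epsilon> R X) =
        whisker L \<epsilon> R X \<cdot>\<^bsub>B\<^esub> whisker L \<epsilon> R (OMap (L \<circ>\<^sub>F R) X)"
      unfolding defs func.simps by (rule \<epsilon>n[OF \<epsilon>X, symmetric])
    show "whisker L \<eta> R X \<cdot>\<^bsub>B\<^esub> whisker L \<epsilon> R X =
        whisker L \<epsilon> R (OMap (L \<circ>\<^sub>F R) X) \<cdot>\<^bsub>B\<^esub> AMap (L \<circ>\<^sub>F R) (whisker L \<eta> R X)"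
      \<comment> \<open>The mixed law is the naturality square of \<open>\<epsilon>\<close> at the
        component of \<open>\<eta>\<close> on \<open>R X\<close>.\<close>
      unfolding defs func.simps by (rule \<epsilon>n[OF \<eta>X])
  qed (rule B is_functor_comp[OF R L])+
qed

text \<open>The second clause quantifies over Frobenius structures whose \<open>\<rho>\<close> and
  \<open>\<rho>'\<close> lie in \<open>K\<close>; by the uniqueness in the first clause these are
  exactly the module structures constructed there.\<close>

theorem proposition3p6:
  fixes A :: "('oa, 'ma) category" and B :: "('ob, 'mb) category"
    and L :: "('oa, 'ma, 'ob, 'mb) func" and R :: "('ob, 'mb, 'oa, 'ma) func"
    and \<eta> \<epsilon> :: "'oa \<Rightarrow> 'ma"
    and K :: "(('ob \<times> 'mb) \<times> 'mb \<times> ('ob \<times> 'mb)) set"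
  assumes "is_category A" and "is_category B"
    and "is_functor A B L" and "is_functor B A R"
    and "is_nat_trans A A id_func (R \<circ>\<^sub>F L) \<eta>"
    and "is_nat_trans A A (R \<circ>\<^sub>F L) id_func \<epsilon>"
    and "ideal_class (comodule_category B (L \<circ>\<^sub>F R) (whisker L \<eta> R)) K"
    and "\<forall>X \<in> Obj B.
      (cofree (L \<circ>\<^sub>F R) (whisker L \<eta> R) (OMap (L \<circ>\<^sub>F R) X), whisker L \<epsilon> R X,
       cofree (L \<circ>\<^sub>F R) (whisker L \<eta> R) X) \<in> K"
  shows
    "(\<forall>X \<omega>. cofirm B (L \<circ>\<^sub>F R) (whisker L \<eta> R) K (X, \<omega>) \<longrightarrow>
       (\<exists>!\<rho>. (cofree (L \<circ>\<^sub>F R) (whisker L \<eta> R) X, \<rho>, (X, \<omega>)) \<in> K \<and>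
          (X, \<rho>, \<omega>) \<in> frobenius_bimodules B (L \<circ>\<^sub>F R) (whisker L \<eta> R) (whisker L \<epsilon> R)))
     \<and>
     (\<forall>X \<omega> \<rho> X' \<omega>' \<rho>' f.
       cofirm B (L \<circ>\<^sub>F R) (whisker L \<eta> R) K (X, \<omega>) \<longrightarrow>
       (cofree (L \<circ>\<^sub>F R) (whisker L \<eta> R) X, \<rho>, (X, \<omega>)) \<in> K \<longrightarrow>
       (X, \<rho>, \<omega>) \<in> frobenius_bimodules B (L \<circ>\<^sub>F R) (whisker L \<eta> R) (whisker L \<epsilon> R) \<longrightarrow>
       cofirm B (L \<circ>\<^sub>F R) (whisker L \<eta> R) K (X', \<omega>') \<longrightarrow>
       (cofree (L \<circ>\<^sub>F R) (whisker L \<eta> R) X', \<rho>', (X', \<omega>')) \<in> K \<longrightarrow>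
       (X', \<rho>', \<omega>') \<in> frobenius_bimodules B (L \<circ>\<^sub>F R) (whisker L \<eta> R) (whisker L \<epsilon> R) \<longrightarrow>
       f \<in> comodule_hom B (L \<circ>\<^sub>F R) (X, \<omega>) (X', \<omega>') \<longrightarrow>
       f \<in> frobenius_hom B (L \<circ>\<^sub>F R) (X, \<rho>, \<omega>) (X', \<rho>', \<omega>'))"
proof -
  interpret frobenius_endofunctor B "L \<circ>\<^sub>F R" "whisker L \<eta> R" "whisker L \<epsilon> R"
    by (rule frobenius_endofunctor_of_pair[OF assms(1-6)])
  note main = cofirm_frobenius_unique_exists[OF assms(7,8)]
    comodule_hom_is_frobenius_hom[OF assms(7,8)]
  show ?thesis
  proof (intro conjI allI impI, goal_cases)
    case 1
    then show ?case by (rule main(1))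
  next
    case 2
    show ?case by (rule main(2)[OF cofirm_comodule(1)[OF 2(1)] 2(2-7)])
  qed
qed

end
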